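(* Let $G$ be a finite, simple, connected $2K_2$-free graph with diameter $3$. Then $c(G) \leq 2$.
   Context: $2K_2$ denotes the graph consisting of two disjoint edges (the complement of the 4-cycle). A graph $G$ is $H$-free if it contains no induced subgraph isomorphic to $H$. The diameter of $G$ is the maximum, over pairs of vertices, of the length of a shortest path between them. The game of cops and robbers on $G$: $k$ cops each choose a starting vertex, then a single robber chooses a vertex; then players alternate turns starting with the cops. On the cops' turn each cop stays put or moves to an adjacent vertex; on the robber's turn he stays put or moves to an adjacent vertex. All moves are visible to both sides. The cops win if at some point a cop occupies the robber's vertex. The cop number $c(G)$ is the minimum number $k$ of cops for which the cops have a winning strategy on $G$. *)

theory Defs
  imports "Graph_Theory.Graph_Theory"
begin

text \<open>
  Finite simple graphs are the \<^locale>\<open>graph\<close>s of the library: finite symmetric digraphs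
  without loops and parallel arcs, an undirected edge being a pair of opposite arcs.
\<close>

definition two_K2 :: "nat pair_pre_digraph" where
  "two_K2 = \<lparr>pverts = {0, 1, 2, 3}, parcs = {(0, 1), (1, 0), (2, 3), (3, 2)}\<rparr>"

definition induced_free :: "('c, 'd) pre_digraph \<Rightarrow> ('a, 'b) pre_digraph \<Rightarrow> bool" where
  "induced_free H G \<longleftrightarrow> \<not> (\<exists>S. induced_subgraph S G \<and> digraph_iso S H)"

text \<open>
  With unit weights, \<open>wf_digraph.\<mu> G\<close> is the length of a shortest walk, \<open>\<infinity>\<close> if there is none.
  On a finite nonempty graph the supremum is a maximum.
\<close>

definition diameter :: "('a, 'b) pre_digraph \<Rightarrow> ereal" where
  "diameter G = (SUP (u, v) \<in> verts G \<times> verts G. wf_digraph.\<mu> G (\<lambda>_. 1) u v)"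

definition game_move :: "('a, 'b) pre_digraph \<Rightarrow> 'a \<Rightarrow> 'a \<Rightarrow> bool" where
  "game_move G u v \<longleftrightarrow> v = u \<or> u \<rightarrow>\<^bsub>G\<^esub> v"

text \<open>
  A play of the robber: \<open>r 0\<close> is his starting vertex and \<open>r t\<close> his position after his
  \<open>t\<close>-th move. Ranging over all such sequences covers every way he may react to the cops.
\<close>

definition robber_play :: "('a, 'b) pre_digraph \<Rightarrow> (nat \<Rightarrow> 'a) \<Rightarrow> bool" where
  "robber_play G r \<longleftrightarrow> r 0 \<in> verts G \<and> (\<forall>t. game_move G (r t) (r (Suc t)))"

text \<open>
  A strategy \<open>\<sigma>\<close> maps the list of all positions of the robber so far, oldest first, to the
  positions of the cops: \<open>\<sigma> [] i\<close> is the starting vertex of cop \<open>i\<close>, chosen before the robber's.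
  Only the values for \<open>i < k\<close> matter. The earlier positions of the cops need not be an
  argument, as \<open>\<sigma>\<close> and the robber's history determine them.
  The order of play is \<open>cop_pos \<sigma> r 0\<close>, \<open>r 0\<close>, \<open>cop_pos \<sigma> r 1\<close>, \<open>r 1\<close>, and so on.
\<close>

type_synonym 'a cop_strategy = "'a list \<Rightarrow> nat \<Rightarrow> 'a"

definition cop_pos :: "'a cop_strategy \<Rightarrow> (nat \<Rightarrow> 'a) \<Rightarrow> nat \<Rightarrow> nat \<Rightarrow> 'a" where
  "cop_pos \<sigma> r t = \<sigma> (map r [0..<t])"

definition legal_strategy :: "('a, 'b) pre_digraph \<Rightarrow> nat \<Rightarrow> 'a cop_strategy \<Rightarrow> bool" where
  "legal_strategy G k \<sigma> \<longleftrightarrow>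
     (\<forall>i<k. \<sigma> [] i \<in> verts G) \<and>
     (\<forall>r. robber_play G r \<longrightarrow>
       (\<forall>t. \<forall>i<k. game_move G (cop_pos \<sigma> r t i) (cop_pos \<sigma> r (Suc t) i)))"

text \<open>
  Capture on the robber's placement or move, or on the cops' next move. The play formally
  continues after a capture, which is harmless since staying put is always allowed.
\<close>

definition captured :: "nat \<Rightarrow> 'a cop_strategy \<Rightarrow> (nat \<Rightarrow> 'a) \<Rightarrow> bool" where
  "captured k \<sigma> r \<longleftrightarrow> (\<exists>t. \<exists>i<k. cop_pos \<sigma> r t i = r t \<or> cop_pos \<sigma> r (Suc t) i = r t)"

definition cops_win :: "('a, 'b) pre_digraph \<Rightarrow> nat \<Rightarrow> bool" where
  "cops_win G k \<longleftrightarrow>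
     (\<exists>\<sigma>. legal_strategy G k \<sigma> \<and> (\<forall>r. robber_play G r \<longrightarrow> captured k \<sigma> r))"

definition cop_number :: "('a, 'b) pre_digraph \<Rightarrow> nat" where
  "cop_number G = (LEAST k. cops_win G k)"

text \<open>The minimum exists on a finite graph: one cop on every vertex wins at once.\<close>

lemma cops_win_card_verts:
  assumes "finite (verts G)"
  shows "cops_win G (card (verts G))"
proof -
  obtain f where f: "bij_betw f {0..<card (verts G)} (verts G)"
    using ex_bij_betw_nat_finite[OF assms] by blast
  define \<sigma> :: "'a cop_strategy" where "\<sigma> = (\<lambda>_. f)"
  have "legal_strategy G (card (verts G)) \<sigma>"
    using bij_betwE[OF f] by (auto simp: legal_strategy_def cop_pos_def game_move_def \<sigma>_def)
  moreover have "captured (card (verts G)) \<sigma> r" if r: "robber_play G r" for r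
  proof -
    obtain i where "i < card (verts G)" "f i = r 0"
      using r f by (force simp: robber_play_def bij_betw_def)
    then show ?thesis
      unfolding captured_def cop_pos_def \<sigma>_def by blast
  qed
  ultimately show ?thesis
    unfolding cops_win_def by blast
qed

end

theory Submission
  imports Defs
begin

text \<open>
  Let \<open>a\<close>, \<open>d\<close> be at distance 3, joined by a path through \<open>c \<in> N(d)\<close>. Since the graph is
  \<open>2K\<^sub>2\<close>-free, all of \<open>N(a)\<close> is adjacent to \<open>c\<close>, and the set \<open>J\<close> of vertices adjacent to
  neither \<open>c\<close> nor \<open>d\<close> is independent, so nonadjacent vertices have nested neighbourhoods in \<open>J\<close>.
  The cops start at \<open>c\<close> and at a vertex \<open>b \<in> N(a)\<close> with as many neighbours in \<open>J\<close> as possible.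
  If the robber's vertex \<open>r\<close> is adjacent to neither, then \<open>b\<close> is adjacent to all neighbours of \<open>r\<close>:
  outside \<open>N(a)\<close> by comparison with the edge \<open>ab\<close>, inside by nestedness and the choice of \<open>b\<close>.
  Hence it suffices that one cop guards from \<open>b\<close> while the other one attacks \<open>r\<close>.
\<close>

text \<open>The robber's move after the reply \<open>q\<close> ends within reach of some cop, who
  captures there. Staying put is the case \<open>s = r\<close>, so \<open>q\<close> must also
  threaten \<open>r\<close> itself.\<close>

lemma cops_winI_second_move:
  assumes start: "\<And>i. i < k \<Longrightarrow> p i \<in> verts G"
    and reply: "\<And>r. r \<in> verts G \<Longrightarrow>
      \<exists>q. (\<forall>i<k. game_move G (p i) (q i)) \<and>
          (\<forall>s. game_move G r s \<longrightarrow> (\<exists>i<k. game_move G (q i) s))"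
  shows "cops_win G k"
proof -
  obtain q where q: "\<And>r i. r \<in> verts G \<Longrightarrow> i < k \<Longrightarrow> game_move G (p i) (q r i)"
    and cover: "\<And>r s. r \<in> verts G \<Longrightarrow> game_move G r s \<Longrightarrow> \<exists>i<k. game_move G (q r i) s"
    using reply by metis
  \<comment> \<open>Only the first two robber positions are read, so the cops stand still from their
    second move on. A cop that cannot reach \<open>s\<close> keeps its place, which keeps the second
    move legal.\<close>
  define \<sigma> :: "'a cop_strategy" where
    "\<sigma> h = (case h of [] \<Rightarrow> p
       | [r] \<Rightarrow> q r
       | r # s # _ \<Rightarrow> (\<lambda>i. if game_move G (q r i) s then s else q r i))" for h
  have pos: "cop_pos \<sigma> r 0 = p" "cop_pos \<sigma> r (Suc 0) = q (r 0)"
    "cop_pos \<sigma> r (Suc (Suc t)) =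
      (\<lambda>i. if game_move G (q (r 0) i) (r (Suc 0)) then r (Suc 0) else q (r 0) i)" for r t
    by (simp_all add: cop_pos_def \<sigma>_def upt_conv_Cons del: upt_Suc)
  have "legal_strategy G k \<sigma>"
    unfolding legal_strategy_def
  proof (intro conjI allI impI)
    fix r t i
    assume r: "robber_play G r" and "i < k"
    show "game_move G (cop_pos \<sigma> r t i) (cop_pos \<sigma> r (Suc t) i)"
    proof (cases t)
      case 0
      then show ?thesis
        using q[of "r 0" i] r \<open>i < k\<close> by (simp add: pos robber_play_def)
    next
      case (Suc t')
      then show ?thesis
        by (cases t') (simp_all add: pos game_move_def)
    qed
  qed (simp add: \<sigma>_def start)
  moreover have "captured k \<sigma> r" if "robber_play G r" for r
  proof -
    have "r 0 \<in> verts G" "game_move G (r 0) (r 1)"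
      using that by (auto simp: robber_play_def)
    then obtain i where "i < k" "game_move G (q (r 0) i) (r 1)"
      using cover by blast
    then have "cop_pos \<sigma> r (Suc 1) i = r 1"
      by (simp add: pos)
    then show ?thesis
      unfolding captured_def using \<open>i < k\<close> by blast
  qed
  ultimately show ?thesis
    unfolding cops_win_def by blast
qed

context graph
begin

lemma adj_sym: "u \<rightarrow> v \<Longrightarrow> v \<rightarrow> u"
  by (rule arcs_ends_symmetric[OF sym_arcs])

lemma adj_in_verts: "u \<rightarrow> v \<Longrightarrow> u \<in> verts G" "u \<rightarrow> v \<Longrightarrow> v \<in> verts G"
  by (auto simp: arcs_ends_conv)

text \<open>Otherwise the four ends are distinct and span an induced copy of
  \<open>two_K2\<close>.\<close>

lemma two_K2_free_edges:
  assumes free: "induced_free two_K2 G" and e1: "u \<rightarrow> v" and e2: "x \<rightarrow> y"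
  shows "u \<rightarrow> x \<or> u \<rightarrow> y \<or> v \<rightarrow> x \<or> v \<rightarrow> y"
proof (rule ccontr)
  assume "\<not> ?thesis"
  then have non: "\<not> u \<rightarrow> x" "\<not> u \<rightarrow> y" "\<not> v \<rightarrow> x" "\<not> v \<rightarrow> y"
    "\<not> x \<rightarrow> u" "\<not> y \<rightarrow> u" "\<not> x \<rightarrow> v" "\<not> y \<rightarrow> v"
    using adj_sym by blast+
  have e: "u \<rightarrow> v" "v \<rightarrow> u" "x \<rightarrow> y" "y \<rightarrow> x"
    using e1 e2 adj_sym by blast+
  have dist: "u \<noteq> v" "x \<noteq> y" "u \<noteq> x" "u \<noteq> y" "v \<noteq> x" "v \<noteq> y"
    using e non adj_not_same by metis+
  define S where "S = G \<restriction> {u, v, x, y}"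
  \<comment> \<open>The default value \<open>3\<close> is the label of \<open>y\<close>.\<close>
  define f :: "'a \<Rightarrow> nat" where "f = (\<lambda>_. 3)(u := 0, v := 1, x := 2)"
  have f: "f u = 0" "f v = 1" "f x = 2" "f y = 3"
    using dist by (auto simp: f_def)
  define hom :: "('a, 'b, nat, nat \<times> nat) digraph_isomorphism" where
    "hom = \<lparr>iso_verts = f, iso_arcs = (\<lambda>e. (f (tail G e), f (head G e))),
            iso_head = snd, iso_tail = fst\<rparr>"
  have S: "induced_subgraph S G"
    unfolding S_def using e adj_in_verts by (intro induced_induce) blast
  have inj: "inj_on f {u, v, x, y}"
    using f by (auto simp: inj_on_def)
  \<comment> \<open>Without parallel arcs, an arc is determined by its ends, hence by their
    labels.\<close>
  have "inj_on (iso_arcs hom) (arcs S)"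
  proof (rule inj_onI)
    fix d e
    assume "d \<in> arcs S" "e \<in> arcs S" "iso_arcs hom d = iso_arcs hom e"
    then show "d = e"
      using inj_onD[OF inj] by (intro no_multi_arcs) (auto simp: S_def hom_def arc_to_ends_def)
  qed
  then have iso: "pre_digraph.digraph_isomorphism S hom"
    unfolding pre_digraph.digraph_isomorphism_def
    using inj S by (auto simp: S_def hom_def)
  have "iso_arcs hom ` arcs S
      = (\<lambda>(a, b). (f a, f b)) ` {(a, b). a \<rightarrow> b \<and> a \<in> {u, v, x, y} \<and> b \<in> {u, v, x, y}}"
    by (force simp: hom_def S_def arcs_ends_conv)
  also have "{(a, b). a \<rightarrow> b \<and> a \<in> {u, v, x, y} \<and> b \<in> {u, v, x, y}}
      = {(u, v), (v, u), (x, y), (y, x)}"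
    using e non adj_not_same by auto
  finally have "with_proj two_K2 = app_iso hom S"
    by (simp add: app_iso_def with_proj_def two_K2_def hom_def S_def f insert_commute)
  then show False
    using free S iso unfolding induced_free_def digraph_iso_def by blast
qed

lemma diameter_attained:
  assumes "verts G \<noteq> {}"
  obtains u v where "u \<in> verts G" "v \<in> verts G" "\<mu> (\<lambda>_. 1) u v = diameter G"
proof -
  let ?D = "(\<lambda>(u, v). \<mu> (\<lambda>_. 1) u v) ` (verts G \<times> verts G)"
  have "finite ?D" "?D \<noteq> {}"
    using assms by auto
  then have "Sup ?D \<in> ?D"
    by (metis Max_Sup Max_in)
  then show thesis
    using that unfolding diameter_def by auto
qed

text \<open>With unit weights cost is length, so a walk attaining the distance has exactly three
  arcs, and each adjacency excluded here would give a walk of at most two.\<close>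

lemma diameter_3_path:
  assumes "verts G \<noteq> {}" and diam: "diameter G = 3"
  obtains a b c d where "a \<rightarrow> b" "b \<rightarrow> c" "c \<rightarrow> d" "a \<noteq> d" "\<not> a \<rightarrow> d" "\<not> a \<rightarrow> c"
    "\<And>x. a \<rightarrow> x \<Longrightarrow> \<not> x \<rightarrow> d"
proof -
  obtain a d where ad: "a \<in> verts G" "d \<in> verts G" "\<mu> (\<lambda>_. 1) a d = 3"
    using diameter_attained[OF assms(1)] diam by metis
  then have "a \<rightarrow>\<^sup>* d"
    using \<mu>_reach_conv[of "\<lambda>_. 1" a d] by simp
  then obtain p where p: "awalk a p d" "awalk_cost (\<lambda>_. 1) p = 3"
    using min_cost_awalk[of a d "\<lambda>_. 1"] ad(3) by (auto simp: apath_def)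
  have cost: "awalk_cost (\<lambda>_. 1) w = length w" for w
    by (induction w) auto
  have short: "3 \<le> length w" if "awalk a w d" for w
    using min_cost_le_walk_cost[OF that, of "\<lambda>_. 1"] ad(3) cost[of w] by simp
  have "length p = 3"
    using p(2) cost[of p] by simp
  then obtain e1 e2 e3 where "p = [e1, e2, e3]"
    by (auto simp: numeral_3_eq_3 length_Suc_conv)
  then have e: "e1 \<in> arcs G" "tail G e1 = a" "e2 \<in> arcs G" "tail G e2 = head G e1"
    "e3 \<in> arcs G" "tail G e3 = head G e2" "head G e3 = d"
    using p(1) by (auto simp: awalk_Cons_iff awalk_Nil_iff)
  have no1: "\<not> a \<rightarrow> d"
  proof
    assume "a \<rightarrow> d"
    then obtain e where "e \<in> arcs G" "tail G e = a" "head G e = d" ..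
    then have "awalk a [e] d"
      by (auto simp: awalk_Cons_iff awalk_Nil_iff)
    from short[OF this] show False
      by simp
  qed
  have no2: "\<not> x \<rightarrow> d" if "a \<rightarrow> x" for x
  proof
    assume "x \<rightarrow> d"
    then obtain e' where e': "e' \<in> arcs G" "tail G e' = x" "head G e' = d" ..
    from that obtain e where "e \<in> arcs G" "tail G e = a" "head G e = x" ..
    with e' have "awalk a [e, e'] d"
      by (auto simp: awalk_Cons_iff awalk_Nil_iff)
    from short[OF this] show False
      by simp
  qed
  have "a \<noteq> d"
    using short[of "[]"] ad by (auto simp: awalk_Nil_iff)
  moreover have "a \<rightarrow> head G e1" "head G e1 \<rightarrow> head G e2" "head G e2 \<rightarrow> d"
    using e by (force simp: arcs_ends_conv)+
  ultimately show thesis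
    using that no1 no2 by blast
qed

lemma connected_has_neighbour:
  assumes "connected G" "u \<in> verts G" "v \<in> verts G" "u \<noteq> v"
  obtains w where "u \<rightarrow> w"
proof -
  have "strongly_connected G"
    using symmetric_connected_imp_strongly_connected sym_arcs assms(1) by blast
  then obtain p where "awalk u p v"
    using assms(2,3) unfolding strongly_connected_def reachable_awalk by blast
  with \<open>u \<noteq> v\<close> obtain e where "e \<in> arcs G" "tail G e = u"
    by (cases p) (auto simp: awalk_Cons_iff awalk_Nil_iff)
  then have "u \<rightarrow> head G e"
    by (force simp: arcs_ends_conv)
  then show thesis ..
qed

text \<open>If both inclusions fail, witnesses \<open>s\<close> and \<open>t\<close> in
  \<open>J\<close> yield edges \<open>x s\<close> and \<open>y t\<close> with no edge between
  them.\<close>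

lemma two_K2_free_neighbours_nested:
  assumes free: "induced_free two_K2 G"
    and indep: "\<And>u v. u \<in> J \<Longrightarrow> v \<in> J \<Longrightarrow> \<not> u \<rightarrow> v"
    and "\<not> x \<rightarrow> y"
  shows "{v \<in> J. x \<rightarrow> v} \<subseteq> {v \<in> J. y \<rightarrow> v} \<or> {v \<in> J. y \<rightarrow> v} \<subseteq> {v \<in> J. x \<rightarrow> v}"
proof (rule ccontr)
  assume "\<not> ?thesis"
  then obtain s t where "s \<in> J" "x \<rightarrow> s" "\<not> y \<rightarrow> s" "t \<in> J" "y \<rightarrow> t" "\<not> x \<rightarrow> t"
    by auto
  then show False
    using two_K2_free_edges[OF free, of x s y t] indep \<open>\<not> x \<rightarrow> y\<close> adj_sym by blast
qed

lemma cops_win_2: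
  assumes "connected G" and free: "induced_free two_K2 G" and diam: "diameter G = 3"
  shows "cops_win G 2"
proof -
  note edges = two_K2_free_edges[OF free]
  have ne: "verts G \<noteq> {}"
    using \<open>connected G\<close> by (simp add: connected_conv)
  obtain a b\<^sub>0 c d where path: "a \<rightarrow> b\<^sub>0" "b\<^sub>0 \<rightarrow> c" "c \<rightarrow> d"
    and far: "a \<noteq> d" "\<not> a \<rightarrow> d" "\<not> a \<rightarrow> c" "\<And>x. a \<rightarrow> x \<Longrightarrow> \<not> x \<rightarrow> d"
    using diameter_3_path[OF ne diam] by metis
  \<comment> \<open>Of the four possible edges between \<open>a x\<close> and \<open>c d\<close>,
    only \<open>x c\<close> is not excluded by \<open>far\<close>.\<close>
  have complete: "x \<rightarrow> c" if "a \<rightarrow> x" for x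
    using edges[OF that path(3)] far that by blast
  define J where "J = {v \<in> verts G. \<not> c \<rightarrow> v \<and> \<not> d \<rightarrow> v}"
  have indep: "\<not> u \<rightarrow> v" if "u \<in> J" "v \<in> J" for u v
    using edges[OF path(3), of u v] that by (auto simp: J_def)
  define N where "N x = {v \<in> J. x \<rightarrow> v}" for x
  have finN: "finite (N x)" for x
    unfolding N_def J_def by simp
  have fin: "finite {x. a \<rightarrow> x}"
    using adj_in_verts by (intro finite_subset[OF _ finite_verts]) auto
  moreover have "{x. a \<rightarrow> x} \<noteq> {}"
    using path(1) by blast
  ultimately obtain b where "b \<in> {x. a \<rightarrow> x}"
    and bmax: "Max ((\<lambda>x. card (N x)) ` {x. a \<rightarrow> x}) = card (N b)"
    by (rule obtains_MAX)
  then have b: "a \<rightarrow> b"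
    by simp
  have max: "card (N x) \<le> card (N b)" if "a \<rightarrow> x" for x
    unfolding bmax[symmetric] using fin that by (intro Max_ge) auto
  define p where "p i = (if i = 0 then b else c)" for i :: nat
  show ?thesis
  proof (rule cops_winI_second_move)
    show "p i \<in> verts G" for i
      using b path adj_in_verts by (auto simp: p_def)
  next
    fix r
    assume r: "r \<in> verts G"
    let ?reply = "\<lambda>q. (\<forall>i<2. game_move G (p i) (q i)) \<and>
      (\<forall>s. game_move G r s \<longrightarrow> (\<exists>i<2. game_move G (q i) s))"
    have replyI: "\<exists>q. ?reply q" if "game_move G b x" "game_move G c y"
      "\<And>s. game_move G r s \<Longrightarrow> game_move G x s \<or> game_move G y s" for x y
      using that
      by (intro exI[of _ "\<lambda>i. if i = 0 then x else y"])
        (auto simp: p_def numeral_2_eq_2 All_less_Suc Ex_less_Suc)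
    have bc: "b \<rightarrow> c"
      using complete b by blast
    show "\<exists>q. ?reply q"
    proof (cases "game_move G b r \<or> game_move G c r")
      case True
      then show ?thesis
        \<comment> \<open>The cop that reaches \<open>r\<close> steps onto it and can then follow
          any move of the robber.\<close>
        using replyI[of r c] replyI[of b r] by (auto simp: game_move_def)
    next
      case False
      then have nbr: "r \<noteq> b" "r \<noteq> c" "\<not> b \<rightarrow> r" "\<not> c \<rightarrow> r"
        by (auto simp: game_move_def)
      \<comment> \<open>\<open>a\<close> is adjacent to \<open>b\<close>, and all neighbours of
        \<open>a\<close> are adjacent to \<open>c\<close>, whereas \<open>r\<close> is adjacent to
        neither cop.\<close>
      have ar: "r \<noteq> a" "\<not> a \<rightarrow> r"
        using nbr b complete adj_sym by blast+
      have guard: "b \<rightarrow> s" if "r \<rightarrow> s" "\<not> a \<rightarrow> s" for s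
        using edges[OF b that(1)] that ar nbr by blast
      show ?thesis
      proof (cases "\<exists>x. a \<rightarrow> x \<and> r \<rightarrow> x")
        case True
        then obtain x where x: "a \<rightarrow> x" "r \<rightarrow> x"
          by blast
        \<comment> \<open>Otherwise \<open>d r\<close> and \<open>a b\<close> would be two edges
          with nothing between them.\<close>
        have "\<not> d \<rightarrow> r"
          using edges[OF b, of d r] far b ar nbr adj_sym by blast
        then have "r \<in> J"
          using r nbr by (simp add: J_def)
        have "b \<rightarrow> s" if "a \<rightarrow> s" "r \<rightarrow> s" for s
        proof (rule ccontr)
          assume "\<not> b \<rightarrow> s"
          then have "N b \<subseteq> N s \<or> N s \<subseteq> N b"
            unfolding N_def using two_K2_free_neighbours_nested[OF free indep] by blast
          moreover have "r \<in> N s" "r \<notin> N b"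
            using that adj_sym \<open>r \<in> J\<close> nbr by (auto simp: N_def)
          \<comment> \<open>The vertex \<open>r\<close> itself makes the inclusion strict, against
            the maximality of \<open>b\<close> in \<open>N(a)\<close>.\<close>
          ultimately have "N b \<subset> N s"
            by blast
          then show False
            using psubset_card_mono[OF finN] max[OF that(1)] by (metis leD)
        qed
        then have "b \<rightarrow> s" if "r \<rightarrow> s" for s
          using that guard by blast
        \<comment> \<open>The cop at \<open>c\<close> attacks from \<open>x\<close>, reachable
          because \<open>x\<close> lies in \<open>N(a)\<close>, while the cop at \<open>b\<close>
          stays on guard.\<close>
        then show ?thesis
          using x complete adj_sym by (intro replyI[of b x]) (auto simp: game_move_def)
      next
        case False
        then have all: "b \<rightarrow> s" if "r \<rightarrow> s" for s
          using that guard by blast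
        obtain x where "r \<rightarrow> x"
          using connected_has_neighbour[OF \<open>connected G\<close> r _ ar(1)] b adj_in_verts by blast
        \<comment> \<open>The roles swap: the cop at \<open>b\<close> attacks from \<open>x\<close>,
          a neighbour of \<open>r\<close> and thus of \<open>b\<close>, and the cop at
          \<open>c\<close> takes over the guard at \<open>b\<close>.\<close>
        then show ?thesis
          using all bc adj_sym by (intro replyI[of x b]) (auto simp: game_move_def)
      qed
    qed
  qed
qed

end

theorem theorem1:
  fixes G :: "('a, 'b) pre_digraph"
  assumes "graph G"
    and "connected G"
    and "induced_free two_K2 G"
    and "diameter G = 3"
  shows "cop_number G \<le> 2"
  using graph.cops_win_2[OF assms] unfolding cop_number_def by (rule Least_le)

end
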